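(* Let $k\in\mathbb{N}$ and $\phi\in\mathrm{Diff}_1(\mathbb{R})$. (i) If $\phi(x)\le x+\frac{s}{4k}$ for all $x\in\mathbb{R}$ for some $s\in(0,1)$, then for every positive path $\{\phi^t\}_{t\in[0,1]}$ from $\mathrm{id}$ to $\phi$ generated by a time-dependent Hamiltonian in $\mathcal{P}_k$, $$\mathrm{length}_V(\{\phi^t\}_{t\in[0,1]})\le\frac{1}{1-s}\int_0^1(\phi(x)-x)\,\mathrm{d}x.$$ (ii) If $\phi(x)>x+\frac1k$ for all $x\in\mathbb{R}$, then there exists $\psi\in\mathrm{Diff}_1(\mathbb{R})$ with $\mathrm{id}<\psi<\phi$ and positive paths from $\mathrm{id}$ to $\psi$ generated by time-dependent Hamiltonians in $\mathcal{P}_k$ with arbitrarily large $\mathrm{length}_V$.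
   Context: $\mathrm{Diff}_1(\mathbb{R})$ is the group of diffeomorphisms $\phi:\mathbb{R}\to\mathbb{R}$ with $\phi(x+1)=\phi(x)+1$ for all $x$; it is ordered by pointwise comparison of functions ($\psi<\phi$ means $\psi(x)<\phi(x)$ for all $x$). A positive path generated by a smooth function $H:[0,1]\times\mathbb{R}\to(0,\infty)$, 1-periodic in $x$, is the solution of $\frac{\mathrm{d}}{\mathrm{d}t}\phi^t=H(t,\phi^t)$, $\phi^0=\mathrm{id}$; it goes from $\mathrm{id}$ to $\phi^1$. Its length is $\mathrm{length}_V(\{\phi^t\}_{t\in[0,1]})=\int_0^1\left(\int_0^1\frac{\mathrm{d}x}{H(t,x)}\right)^{-1}\mathrm{d}t$. $\mathcal{P}_k$ is the space of smooth functions on $[0,1]\times\mathbb{R}$ of the form $p(t,x)=\sum_{j=0}^k(a_j(t)\cos(2\pi jx)+b_j(t)\sin(2\pi jx))$ with smooth $a_j,b_j$. *)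

theory Defs
  imports "HOL-Analysis.Analysis"
begin

definition smooth :: "(real \<Rightarrow> real) \<Rightarrow> bool" where
  "smooth f \<longleftrightarrow> (\<forall>n x. ((deriv ^^ n) f) differentiable (at x))"

definition Diff1 :: "(real \<Rightarrow> real) set" where
  "Diff1 = {\<phi>. bij \<phi> \<and> smooth \<phi> \<and> smooth (inv \<phi>) \<and> (\<forall>x. \<phi> (x + 1) = \<phi> x + 1)}"

definition in_Pk :: "nat \<Rightarrow> (real \<Rightarrow> real \<Rightarrow> real) \<Rightarrow> bool" where
  "in_Pk k H \<longleftrightarrow> (\<exists>a b :: nat \<Rightarrow> real \<Rightarrow> real.
      (\<forall>j. smooth (a j) \<and> smooth (b j)) \<and>
      (\<forall>t\<in>{0..1}. \<forall>x. H t x =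
         (\<Sum>j\<le>k. a j t * cos (2 * pi * real j * x) + b j t * sin (2 * pi * real j * x))))"

definition positive_path_gen ::
  "(real \<Rightarrow> real \<Rightarrow> real) \<Rightarrow> (real \<Rightarrow> real \<Rightarrow> real) \<Rightarrow> (real \<Rightarrow> real) \<Rightarrow> bool" where
  "positive_path_gen H \<Phi> \<psi> \<longleftrightarrow>
     (\<forall>t\<in>{0..1}. \<forall>x. H t x > 0) \<and>
     \<Phi> 0 = id \<and>
     (\<forall>x. \<forall>t\<in>{0..1}. ((\<lambda>s. \<Phi> s x) has_real_derivative H t (\<Phi> t x)) (at t within {0..1})) \<and>
     \<Phi> 1 = \<psi>"

definition lengthV :: "(real \<Rightarrow> real \<Rightarrow> real) \<Rightarrow> real" where
  "lengthV H = integral {0..1} (\<lambda>t. inverse (integral {0..1} (\<lambda>x. 1 / H t x)))"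

end

theory Submission
  imports Defs
begin

text \<open>
  (i) M. Riesz' interpolation formula writes the derivative of a trigonometric polynomial of degree
  \<open>k\<close> as an alternating combination of \<open>2k\<close> of its translates with total weight \<open>2 \<pi> k\<close>. For a
  nonnegative polynomial \<open>T\<close> only the negative half of the weights, \<open>\<pi> k\<close>, counts towards a lower bound
  of \<open>T'\<close>. Hence sampling \<open>T\<close> at points \<open>x + u x\<close> with \<open>0 \<le> u x \<le> s / (4 k)\<close> instead of \<open>x\<close> decreases
  its mean by at most the factor \<open>1 - s \<pi> / 4 \<ge> 1 - s\<close>. Apply this to \<open>H t\<close>, whose arithmetic mean
  dominates its harmonic mean, and integrate over \<open>t\<close>.

  (ii) Let \<open>q y = \<alpha> - M cos (2 \<pi> k y)\<close> with \<open>\<alpha>\<^sup>2 - M\<^sup>2 = 1 / k\<^sup>2\<close>. The time-one flow of \<open>q\<close> is exactly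
  the translation by \<open>1 / k\<close>, whatever \<open>\<alpha>\<close>. Viewed in a frame moving with speed \<open>v\<close>, the Hamiltonian
  \<open>v + q (x - v t)\<close> generates the translation by \<open>1 / k + v\<close>, and its harmonic mean
  \<open>sqrt ((v + \<alpha>)\<^sup>2 - M\<^sup>2) \<ge> sqrt (2 v \<alpha>)\<close> is unbounded in \<open>\<alpha>\<close>.
\<close>

section \<open>Nodes, weights and trigonometric moments of M. Riesz' interpolation formula\<close>

text \<open>These are the \<open>2 * n\<close> zeros of \<open>cos (n * y)\<close> in one
  period.\<close>

definition riesz_node :: "nat \<Rightarrow> nat \<Rightarrow> real" where
  "riesz_node n r = (2 * real r + 1) * pi / (2 * real n)"

text \<open>Equal to \<open>1 / (2 * sin (y / 2) ^ 2)\<close> at the node \<open>y\<close>, the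
  classical weight up to a constant factor. Normalisation is postponed: later the weights are
  divided by their sum, whose value is never computed.\<close>

definition riesz_weight :: "nat \<Rightarrow> nat \<Rightarrow> real" where
  "riesz_weight n r = 1 / (1 - cos (riesz_node n r))"

text \<open>The nodes are equally spaced, so multiplying by \<open>2 * sin h\<close>, with
  \<open>h\<close> half the step of the angles, makes the sum telescope to a sine at a multiple of
  \<open>2 * pi\<close>. The bounds on \<open>l\<close> keep \<open>h\<close> inside
  \<open>(0, pi)\<close>, hence \<open>sin h\<close> nonzero.\<close>

lemma sum_cos_riesz_node:
  assumes "0 < l" "l < 2 * n"
  shows "(\<Sum>r<2*n. cos (real l * riesz_node n r)) = 0"
proof -
  define h where "h = real l * pi / (2 * real n)"
  have "0 < h" "h < pi" using assms by (auto simp: h_def field_simps)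
  then have s: "sin h > 0" by (rule sin_gt_zero)
  have step: "2 * sin h * cos (real l * riesz_node n r) = sin (2 * real (Suc r) * h) - sin (2 * real r * h)" for r
  proof -
    have e: "real l * riesz_node n r = 2 * real r * h + h" using assms by (simp add: riesz_node_def h_def field_simps)
    have e2: "2 * real (Suc r) * h = (2 * real r * h + h) + h" by (simp add: algebra_simps)
    have e3: "2 * real r * h = (2 * real r * h + h) - h" by simp
    show ?thesis unfolding e
      by (subst e2, subst (3) e3, unfold sin_add[of _ h] sin_diff) (simp add: algebra_simps)
  qed
  have "2 * sin h * (\<Sum>r<2*n. cos (real l * riesz_node n r)) = (\<Sum>r<2*n. sin (2 * real (Suc r) * h) - sin (2 * real r * h))"
    unfolding sum_distrib_left step ..
  also have "\<dots> = sin (2 * real (2*n) * h)"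
    by (subst sum_lessThan_telescope) simp
  also have "2 * real (2*n) * h = 2 * pi * real l" using assms by (simp add: h_def field_simps)
  also have "sin (2 * pi * real l) = 0" by (metis mult.commute mult.left_commute sin_2npi)
  finally show ?thesis using s by simp
qed

lemma sin_n_riesz_node:
  assumes "n \<ge> 1"
  shows "sin (real n * riesz_node n r) = (-1) ^ r"
proof -
  have e: "real n * riesz_node n r = real r * pi + pi / 2" using assms by (simp add: riesz_node_def field_simps)
  show ?thesis unfolding e sin_add by (simp add: cos_npi)
qed

lemma cos_riesz_node_less_one:
  assumes "r < 2 * n"
  shows "cos (riesz_node n r) < 1"
proof -
  have p: "0 < riesz_node n r" using assms by (simp add: riesz_node_def)
  have "2 * real r + 1 < 4 * real n" using assms by linarith
  then have "(2 * real r + 1) * pi < 4 * real n * pi" by simp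
  then have q: "riesz_node n r < 2 * pi" using assms by (simp add: riesz_node_def field_simps)
  have "cos (riesz_node n r) \<noteq> 1"
  proof
    assume "cos (riesz_node n r) = 1"
    then obtain m :: int where m: "riesz_node n r = of_int m * 2 * pi" using cos_one_2pi_int by blast
    have "0 < of_int m * (2 * pi)" "of_int m * (2*pi) < 1 * (2 * pi)" using p q m by (auto simp: mult.assoc)
    then have "0 < (of_int m::real)" "(of_int m::real) < 1"
      using pi_gt_zero by (simp_all add: zero_less_mult_iff mult_less_cancel_right)
    then show False by simp
  qed
  then show ?thesis using cos_le_one[of "riesz_node n r"] by linarith
qed

lemma riesz_weight_pos: "r < 2 * n \<Longrightarrow> riesz_weight n r > 0"
  using cos_riesz_node_less_one[of r n] by (simp add: riesz_weight_def)

text \<open>The reflection \<open>r\<close> to \<open>2 * n - 1 - r\<close> replaces a node by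
  \<open>2 * pi\<close> minus it. This preserves weight and cosine but changes the parity of
  \<open>r\<close>, so the sum equals its own negative.\<close>

lemma sum_alternating_cos:
  assumes "n \<ge> 1"
  shows "(\<Sum>r<2*n. (-1) ^ r * riesz_weight n r * cos (real j * riesz_node n r)) = 0" (is "?S = 0")
proof -
  have sym: "riesz_node n (2*n - Suc r) = 2 * pi - riesz_node n r" if "r < 2*n" for r
    using that by (simp add: riesz_node_def of_nat_diff field_simps)
  have "?S = (\<Sum>r<2*n. (-1) ^ (2*n - Suc r) * riesz_weight n (2*n - Suc r) * cos (real j * riesz_node n (2*n - Suc r)))"
    by (rule sum.nat_diff_reindex[symmetric])
  also have "\<dots> = (\<Sum>r<2*n. - ((-1) ^ r * riesz_weight n r * cos (real j * riesz_node n r)))"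
  proof (rule sum.cong[OF refl])
    fix r assume "r \<in> {..<2*n}"
    then have r: "r < 2*n" by simp
    have 1: "(-1::real) ^ (2*n - Suc r) = - ((-1) ^ r)"
      using r by (cases "even r") (auto simp: minus_one_power_iff)
    have 2: "riesz_weight n (2*n - Suc r) = riesz_weight n r"
      by (simp add: riesz_weight_def sym[OF r] cos_diff)
    have "real j * riesz_node n (2*n - Suc r) = 2 * pi * real j - real j * riesz_node n r"
      unfolding sym[OF r] by (simp add: algebra_simps)
    moreover have "cos (2 * pi * real j - y) = cos y" for y
      using cos_2npi[of j] sin_2npi[of j] by (simp add: cos_diff mult_ac)
    ultimately show "(-1) ^ (2*n - Suc r) * riesz_weight n (2*n - Suc r) * cos (real j * riesz_node n (2*n - Suc r))
      = - ((-1) ^ r * riesz_weight n r * cos (real j * riesz_node n r))" by (simp add: 1 2)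
  qed
  also have "\<dots> = - ?S" by (rule sum_negf)
  finally show ?thesis by linarith
qed

text \<open>At the nodes \<open>(-1) ^ r\<close> is \<open>sin (n * y)\<close>. The product formula
  then leaves cosines of frequencies \<open>n - j\<close> and \<open>n + j\<close>, both strictly
  between \<open>0\<close> and \<open>2 * n\<close>.\<close>

lemma sum_alternating_sin_zero:
  assumes "0 < j" "j < n"
  shows "(\<Sum>r<2*n. (-1) ^ r * sin (real j * riesz_node n r)) = 0"
proof -
  have "(-1) ^ r * sin (real j * riesz_node n r)
      = (cos (real (n - j) * riesz_node n r) - cos (real (n + j) * riesz_node n r)) / 2" for r
  proof -
    have e: "real (n - j) * riesz_node n r = real n * riesz_node n r - real j * riesz_node n r"
      "real (n + j) * riesz_node n r = real n * riesz_node n r + real j * riesz_node n r"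
      using assms by (simp_all add: algebra_simps of_nat_diff)
    have "sin (real n * riesz_node n r) = (-1) ^ r" using assms by (intro sin_n_riesz_node) simp
    then show ?thesis unfolding e by (simp add: cos_diff cos_add)
  qed
  then have "(\<Sum>r<2*n. (-1) ^ r * sin (real j * riesz_node n r))
      = ((\<Sum>r<2*n. cos (real (n - j) * riesz_node n r)) - (\<Sum>r<2*n. cos (real (n + j) * riesz_node n r))) / 2"
    by (simp only: sum_subtractf flip: sum_divide_distrib)
  also have "\<dots> = 0"
    using assms by (subst (1 2) sum_cos_riesz_node) auto
  finally show ?thesis .
qed

lemma sum_alternating_sin:
  assumes "n \<ge> 1" "j \<le> n"
  shows "real n * (\<Sum>r<2*n. (-1) ^ r * riesz_weight n r * sin (real j * riesz_node n r))
       = real j * (\<Sum>r<2*n. riesz_weight n r)"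
proof -
  define s where "s j = (\<Sum>r<2*n. (-1) ^ r * riesz_weight n r * sin (real j * riesz_node n r))" for j
  \<comment> \<open>The factor \<open>1 - cos\<close> cancels the weight, so \<open>s\<close> has vanishing second differences.\<close>
  have rec: "s (Suc (Suc j)) = 2 * s (Suc j) - s j" if "Suc j < n" for j
  proof -
    have *: "2 * ((-1) ^ r * riesz_weight n r * sin (real (Suc j) * riesz_node n r))
        - (-1) ^ r * riesz_weight n r * sin (real j * riesz_node n r)
        - (-1) ^ r * riesz_weight n r * sin (real (Suc (Suc j)) * riesz_node n r)
        = 2 * ((-1) ^ r * sin (real (Suc j) * riesz_node n r))" if "r < 2*n" for r
    proof -
      define y where "y = real (Suc j) * riesz_node n r"
      define z where "z = riesz_node n r"
      have e: "real j * riesz_node n r = y - z" "real (Suc (Suc j)) * riesz_node n r = y + z"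
        by (simp_all add: y_def z_def algebra_simps)
      have w: "riesz_weight n r * (1 - cos z) = 1"
        using cos_riesz_node_less_one[OF that] by (simp add: riesz_weight_def z_def)
      have "2 * ((-1) ^ r * riesz_weight n r * sin y) - (-1) ^ r * riesz_weight n r * sin (y - z)
        - (-1) ^ r * riesz_weight n r * sin (y + z) = 2 * ((-1)^r * sin y) * (riesz_weight n r * (1 - cos z))"
        by (simp add: sin_add sin_diff algebra_simps)
      then show ?thesis unfolding e w y_def[symmetric] by simp
    qed
    have "2 * s (Suc j) - s j - s (Suc (Suc j)) = (\<Sum>r<2*n. 2 * ((-1) ^ r * sin (real (Suc j) * riesz_node n r)))"
      unfolding s_def sum_distrib_left[of 2] sum_subtractf[symmetric]
      by (rule sum.cong) (use * in auto)
    also have "\<dots> = 0" using sum_alternating_sin_zero[of "Suc j" n] that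
      by (simp flip: sum_distrib_left)
    finally show ?thesis by linarith
  qed
  \<comment> \<open>Since \<open>s 0 = 0\<close>, vanishing second differences make \<open>s\<close>
    linear up to \<open>n\<close>.\<close>
  have lin: "s j = real j * s 1" if "j \<le> n" for j
    using that
  proof (induction j rule: induct_nat_012)
    case (ge2 j)
    then show ?case using rec[of j] by (simp add: algebra_simps)
  qed (simp_all add: s_def)
  \<comment> \<open>The slope is read off at \<open>j = n\<close>, where the sine equals
    \<open>(-1) ^ r\<close> and cancels the alternating sign.\<close>
  have "s n = (\<Sum>r<2*n. riesz_weight n r)"
    unfolding s_def sin_n_riesz_node[OF assms(1)] by (rule sum.cong) (simp_all flip: power_mult_distrib add: mult.commute mult.left_commute)
  then have "(\<Sum>r<2*n. riesz_weight n r) = real n * s 1" using lin[of n] by simp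
  then show ?thesis using lin[OF assms(2)] unfolding s_def[symmetric] by simp
qed

section \<open>Trigonometric polynomials and a one-sided Bernstein inequality\<close>

definition trig_poly :: "nat \<Rightarrow> (nat \<Rightarrow> real) \<Rightarrow> (nat \<Rightarrow> real) \<Rightarrow> real \<Rightarrow> real" where
  "trig_poly k a b x = (\<Sum>j\<le>k. a j * cos (2 * pi * real j * x) + b j * sin (2 * pi * real j * x))"

text \<open>Only the constant mode survives integration over a period. The shift \<open>c\<close> is
  carried along because translates of one polynomial are averaged later.\<close>

lemma has_integral_trig_poly:
  "((\<lambda>x. trig_poly k a b (x + c)) has_integral a 0) {0..1}"
proof -
  have "((\<lambda>x. a j * cos (2 * pi * real j * (x + c)) + b j * sin (2 * pi * real j * (x + c)))
      has_integral (if j = 0 then a 0 else 0)) {0..1}" for j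
  proof (cases "j = 0")
    case True
    then show ?thesis using has_integral_const_real[of "a 0" 0 1] by simp
  next
    case False
    define m where "m = 2 * pi * real j"
    have m: "m > 0" using False by (simp add: m_def)
    let ?F = "\<lambda>x. a j * (sin (m * (x + c)) / m) - b j * (cos (m * (x + c)) / m)"
    have "((\<lambda>x. a j * cos (m * (x + c)) + b j * sin (m * (x + c))) has_integral ?F 1 - ?F 0) {0..1}"
      using m by (intro fundamental_theorem_of_calculus)
        (auto intro!: derivative_eq_intros simp flip: has_real_derivative_iff_has_vector_derivative)
    moreover have "sin (m * (1 + c)) = sin (m * c)" "cos (m * (1 + c)) = cos (m * c)"
      using cos_2npi[of j] sin_2npi[of j]
      by (simp_all add: distrib_left sin_add cos_add m_def mult_ac)
    ultimately show ?thesis using False by (simp add: m_def)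
  qed
  then have "((\<lambda>x. trig_poly k a b (x + c)) has_integral (\<Sum>j\<le>k. if j = 0 then a 0 else 0)) {0..1}"
    unfolding trig_poly_def by (intro has_integral_sum) auto
  then show ?thesis by simp
qed

text \<open>By linearity it suffices to test each frequency \<open>j\<close>. The addition theorems
  reduce this to the two alternating moments: the cosine moment \<open>C\<close> vanishes and the
  sine moment \<open>S\<close> produces exactly the factor \<open>j\<close> of the
  derivative.\<close>

lemma trig_poly_riesz:
  assumes "k \<ge> 1"
  defines "A \<equiv> (\<Sum>r<2*k. riesz_weight k r)"
  shows "(trig_poly k a b has_real_derivative
      (\<Sum>r<2*k. (-1) ^ r * (2 * pi * real k / A * riesz_weight k r) * trig_poly k a b (x + riesz_node k r / (2 * pi)))) (at x)"
proof -
  have A: "A > 0" unfolding A_def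
    using assms(1) riesz_weight_pos[of _ k] by (intro sum_pos) (auto simp: lessThan_empty_iff)
  have per: "a j * (- sin (2 * pi * real j * x) * (2 * pi * real j)) + b j * (cos (2 * pi * real j * x) * (2 * pi * real j))
    = (\<Sum>r<2*k. (-1) ^ r * (2 * pi * real k / A * riesz_weight k r) *
        (a j * cos (2 * pi * real j * (x + riesz_node k r / (2 * pi))) + b j * sin (2 * pi * real j * (x + riesz_node k r / (2 * pi)))))"
    if j: "j \<le> k" for j
  proof -
    define y where "y = 2 * pi * real j * x"
    define C where "C = (\<Sum>r<2*k. (-1) ^ r * riesz_weight k r * cos (real j * riesz_node k r))"
    define S where "S = (\<Sum>r<2*k. (-1) ^ r * riesz_weight k r * sin (real j * riesz_node k r))"
    have C: "C = 0" unfolding C_def by (rule sum_alternating_cos[OF assms(1)])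
    have S: "real k * S = real j * A" unfolding S_def A_def by (rule sum_alternating_sin[OF assms(1) j])
    have e: "2 * pi * real j * (x + riesz_node k r / (2 * pi)) = y + real j * riesz_node k r" for r
      by (simp add: y_def field_simps)
    have "(\<Sum>r<2*k. (-1) ^ r * (2 * pi * real k / A * riesz_weight k r) *
        (a j * cos (y + real j * riesz_node k r) + b j * sin (y + real j * riesz_node k r)))
      = 2 * pi * real k / A * ((a j * cos y + b j * sin y) * C + (b j * cos y - a j * sin y) * S)"
      unfolding C_def S_def sum_distrib_left sum.distrib[symmetric]
      by (rule sum.cong) (simp_all add: cos_add sin_add algebra_simps)
    also have "\<dots> = 2 * pi / A * (b j * cos y - a j * sin y) * (real k * S)" by (simp add: C)
    also have "\<dots> = 2 * pi * real j * (b j * cos y - a j * sin y)" unfolding S using A by simp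
    finally show ?thesis unfolding e y_def[symmetric] by (simp add: algebra_simps)
  qed
  have "(trig_poly k a b has_real_derivative
     (\<Sum>j\<le>k. a j * (- sin (2 * pi * real j * x) * (2 * pi * real j)) + b j * (cos (2 * pi * real j * x) * (2 * pi * real j)))) (at x)"
    unfolding trig_poly_def[abs_def] by (intro DERIV_sum) (auto intro!: derivative_eq_intros)
  also have "(\<Sum>j\<le>k. a j * (- sin (2 * pi * real j * x) * (2 * pi * real j)) + b j * (cos (2 * pi * real j * x) * (2 * pi * real j)))
    = (\<Sum>j\<le>k. \<Sum>r<2*k. (-1) ^ r * (2 * pi * real k / A * riesz_weight k r) *
        (a j * cos (2 * pi * real j * (x + riesz_node k r / (2 * pi))) + b j * sin (2 * pi * real j * (x + riesz_node k r / (2 * pi)))))"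
    by (rule sum.cong) (use per in auto)
  also have "\<dots> = (\<Sum>r<2*k. (-1) ^ r * (2 * pi * real k / A * riesz_weight k r) * trig_poly k a b (x + riesz_node k r / (2 * pi)))"
    unfolding trig_poly_def sum_distrib_left by (rule sum.swap)
  finally show ?thesis .
qed

text \<open>In Riesz' formula the even nodes contribute nonnegative terms and may be dropped;
  \<open>d\<close> keeps the weights of the odd ones. Neither \<open>d\<close> nor
  \<open>\<tau>\<close> depends on the polynomial or on \<open>x\<close>, so one choice serves all
  times.\<close>

lemma trig_poly_one_sided_bernstein:
  assumes "k \<ge> 1"
  obtains d \<tau> :: "nat \<Rightarrow> real" where
    "\<And>r. d r \<ge> 0" "(\<Sum>r<2*k. d r) = pi * real k"
    "\<And>a b x. (\<And>y. trig_poly k a b y \<ge> 0) \<Longrightarrow>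
      \<exists>D. (trig_poly k a b has_real_derivative D) (at x) \<and> D \<ge> - (\<Sum>r<2*k. d r * trig_poly k a b (x + \<tau> r))"
proof -
  define A where "A = (\<Sum>r<2*k. riesz_weight k r)"
  define d where "d r = (if odd r \<and> r < 2*k then 2 * pi * real k / A * riesz_weight k r else 0)" for r
  have A: "A > 0" unfolding A_def
    using assms(1) riesz_weight_pos[of _ k] by (intro sum_pos) (auto simp: lessThan_empty_iff)
  have d: "d r \<ge> 0" for r using A riesz_weight_pos[of r k] by (auto simp: d_def intro!: divide_nonneg_pos mult_nonneg_nonneg)
  \<comment> \<open>Frequency \<open>0\<close> of the cosine moments: even and odd nodes carry equal
    total weight, so the odd ones account for half of \<open>2 * pi * k\<close>.\<close>
  have alt: "(\<Sum>r<2*k. (-1) ^ r * riesz_weight k r) = 0" using sum_alternating_cos[OF assms, of 0] by simp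
  have "(\<Sum>r<2*k. d r) = pi * real k / A * (\<Sum>r<2*k. riesz_weight k r - (-1) ^ r * riesz_weight k r)"
    unfolding sum_distrib_left by (rule sum.cong) (auto simp: d_def)
  also have "\<dots> = pi * real k" using A by (simp add: sum_subtractf alt flip: A_def)
  finally have sd: "(\<Sum>r<2*k. d r) = pi * real k" .
  show thesis
  proof (rule that[of d "\<lambda>r. riesz_node k r / (2*pi)"])
    fix a b x assume nn: "\<And>y. trig_poly k a b y \<ge> 0"
    have "- (\<Sum>r<2*k. d r * trig_poly k a b (x + riesz_node k r / (2*pi)))
      \<le> (\<Sum>r<2*k. (-1) ^ r * (2 * pi * real k / A * riesz_weight k r) * trig_poly k a b (x + riesz_node k r / (2 * pi)))"
      unfolding sum_negf[symmetric]
    proof (rule sum_mono)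
      fix r assume "r \<in> {..<2*k}"
      then have "riesz_weight k r > 0" "r < 2*k" using riesz_weight_pos by auto
      then show "- (d r * trig_poly k a b (x + riesz_node k r / (2*pi))) \<le>
        (-1) ^ r * (2 * pi * real k / A * riesz_weight k r) * trig_poly k a b (x + riesz_node k r / (2 * pi))"
        using nn[of "x + riesz_node k r / (2 * pi)"] A by (cases "odd r") (auto simp: d_def)
    qed
    then show "\<exists>D. (trig_poly k a b has_real_derivative D) (at x) \<and> D \<ge> - (\<Sum>r<2*k. d r * trig_poly k a b (x + riesz_node k r / (2*pi)))"
      using trig_poly_riesz[OF assms, of a b x] unfolding A_def by blast
  qed (use d sd in auto)
qed


lemma continuous_on_trig_poly [continuous_intros]:
  fixes g :: "'c::t2_space \<Rightarrow> real"
  assumes "\<And>j. continuous_on S (\<lambda>z. a z j)" "\<And>j. continuous_on S (\<lambda>z. b z j)" "continuous_on S g"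
  shows "continuous_on S (\<lambda>z. trig_poly k (a z) (b z) (g z))"
  unfolding trig_poly_def by (intro continuous_intros assms)

text \<open>Integrate the one-sided derivative bound from \<open>x\<close> to \<open>x + u\<close>.
  The subtracted integrand is nonnegative, so extending the integral from \<open>{0..u}\<close> to
  \<open>{0..\<delta>}\<close> only weakens the bound and removes \<open>u\<close> from its left
  side.\<close>

lemma trig_poly_shift_lower:
  assumes "k \<ge> 1"
  obtains d \<tau> :: "nat \<Rightarrow> real" where
    "(\<Sum>r<2*k. d r) = pi * real k"
    "\<And>a b x u \<delta>. (\<And>y. trig_poly k a b y \<ge> 0) \<Longrightarrow> 0 \<le> u \<Longrightarrow> u \<le> \<delta> \<Longrightarrow>
      trig_poly k a b x - integral {0..\<delta>} (\<lambda>v. \<Sum>r<2*k. d r * trig_poly k a b (x + v + \<tau> r))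
        \<le> trig_poly k a b (x + u)"
proof -
  obtain d \<tau> :: "nat \<Rightarrow> real" where d: "\<And>r. d r \<ge> 0" "(\<Sum>r<2*k. d r) = pi * real k"
    and D: "\<And>a b x. (\<And>y. trig_poly k a b y \<ge> 0) \<Longrightarrow>
      \<exists>D. (trig_poly k a b has_real_derivative D) (at x) \<and> D \<ge> - (\<Sum>r<2*k. d r * trig_poly k a b (x + \<tau> r))"
    by (rule trig_poly_one_sided_bernstein[OF assms]) blast
  show thesis
  proof (rule that[of d \<tau>])
    fix a b x and u \<delta> :: real
    assume nn: "\<And>y. trig_poly k a b y \<ge> 0" and u: "0 \<le> u" "u \<le> \<delta>"
    let ?N = "\<lambda>v. \<Sum>r<2*k. d r * trig_poly k a b (x + v + \<tau> r)"
    have int: "?N integrable_on {0..w}" for w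
      by (intro integrable_continuous_interval continuous_intros)
    have "\<forall>y. \<exists>D. (trig_poly k a b has_real_derivative D) (at y) \<and> D \<ge> - (\<Sum>r<2*k. d r * trig_poly k a b (y + \<tau> r))"
      using D[OF nn] by blast
    then obtain T' where T': "\<And>y. (trig_poly k a b has_real_derivative T' y) (at y)"
      "\<And>y. T' y \<ge> - (\<Sum>r<2*k. d r * trig_poly k a b (y + \<tau> r))" by metis
    have chain: "((\<lambda>v. trig_poly k a b (x + v)) has_real_derivative T' (x + w)) (at w)" for w
      using T'(1)[of "w + x"] unfolding DERIV_shift by (simp add: add.commute)
    have T: "((\<lambda>v. T' (x + v)) has_integral trig_poly k a b (x + u) - trig_poly k a b (x + 0)) {0..u}"
      using u by (intro fundamental_theorem_of_calculus)
        (auto intro: DERIV_subset[OF chain] simp flip: has_real_derivative_iff_has_vector_derivative)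
    have N: "((\<lambda>v. - ?N v) has_integral - integral {0..u} ?N) {0..u}"
      by (intro has_integral_neg integrable_integral int)
    have "- integral {0..u} ?N \<le> trig_poly k a b (x + u) - trig_poly k a b (x + 0)"
      by (rule has_integral_le[OF N T T'(2)])
    moreover have "integral {0..u} ?N \<le> integral {0..\<delta>} ?N"
      using u nn d(1) by (intro integral_subset_le int) (auto intro!: sum_nonneg)
    ultimately show "trig_poly k a b x - integral {0..\<delta>} ?N \<le> trig_poly k a b (x + u)" by simp
  qed (use d in auto)
qed

section \<open>Harmonic means and the upper bound on the length\<close>

lemma harmonic_le_arithmetic_mean:
  fixes f :: "real \<Rightarrow> real"
  assumes cont: "continuous_on {0..1} f" and pos: "\<And>x. x \<in> {0..1} \<Longrightarrow> f x > 0"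
  shows "inverse (integral {0..1} (\<lambda>x. 1 / f x)) \<le> integral {0..1} f"
proof -
  define m where "m = integral {0..1} f"
  define J where "J = integral {0..1} (\<lambda>x. 1 / f x)"
  have J: "((\<lambda>x. 1 / f x) has_integral J) {0..1}" unfolding J_def
    using pos by (intro integrable_integral integrable_continuous_interval continuous_intros cont) force
  have m: "(f has_integral m) {0..1}" unfolding m_def
    by (intro integrable_integral integrable_continuous_interval cont)
  \<comment> \<open>Integrated form of \<open>(1 - f x * y)^2 / f x \<ge> 0\<close>. A large
    \<open>y\<close> will force \<open>m > 0\<close>, and the optimal \<open>y = inverse m\<close>
    gives the comparison of means.\<close>
  have key: "2 * y - m * y\<^sup>2 \<le> J" for y
  proof (rule has_integral_le[OF _ J])
    show "((\<lambda>x. 2 * y - f x * y\<^sup>2) has_integral 2 * y - m * y\<^sup>2) {0..1}"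
      using has_integral_diff[OF has_integral_const_real[of "2*y" 0 1] has_integral_mult_left[OF m, of "y\<^sup>2"]] by simp
    fix x :: real assume "x \<in> {0..1}"
    then have p: "f x > 0" by (rule pos)
    have "0 \<le> (1 - f x * y)\<^sup>2 / f x" using p by simp
    also have "\<dots> = 1 / f x - (2 * y - f x * y\<^sup>2)" using p by (simp add: power2_eq_square field_simps)
    finally show "2 * y - f x * y\<^sup>2 \<le> 1 / f x" by simp
  qed
  have "m > 0"
  proof (rule ccontr)
    assume "\<not> m > 0"
    define y where "y = \<bar>J\<bar> + 1"
    have "m * y\<^sup>2 \<le> 0" using \<open>\<not> m > 0\<close> by (simp add: mult_nonpos_nonneg)
    moreover have "J < 2 * y" by (simp add: y_def)
    ultimately show False using key[of y] by linarith
  qed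
  then have "inverse m \<le> J" using key[of "inverse m"] by (simp add: power2_eq_square field_simps)
  then show ?thesis using \<open>m > 0\<close> unfolding m_def[symmetric] J_def[symmetric]
    by (metis inverse_inverse_eq inverse_positive_iff_positive le_imp_inverse_le)
qed

lemma smooth_imp_continuous_on: "smooth f \<Longrightarrow> continuous_on S f"
  unfolding smooth_def by (metis funpow_0 differentiable_imp_continuous_within continuous_at_imp_continuous_on)

text \<open>The lower bound \<open>K t x\<close> for \<open>H t (\<Phi> t x)\<close> does not involve the flow, so no regularity
  of \<open>\<Phi>\<close> in \<open>x\<close> is needed to exchange the two integrations.\<close>

lemma lengthV_le:
  assumes k: "k \<ge> 1" and H: "in_Pk k H" and path: "positive_path_gen H \<Phi> \<phi>"
    and s: "0 < s" "s < 1" and le: "\<And>x. \<phi> x \<le> x + s / (4 * real k)"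
    and cont: "continuous_on {0..1} \<phi>"
  shows "lengthV H \<le> 1 / (1 - s) * integral {0..1} (\<lambda>x. \<phi> x - x)"
proof -
  obtain a b where sm: "\<And>j. smooth (a j)" "\<And>j. smooth (b j)"
    and H': "\<And>t x. t \<in> {0..1} \<Longrightarrow> H t x =
      (\<Sum>j\<le>k. a j t * cos (2 * pi * real j * x) + b j t * sin (2 * pi * real j * x))"
    using H unfolding in_Pk_def by blast
  define T where "T t = trig_poly k (\<lambda>j. a j t) (\<lambda>j. b j t)" for t
  have HT: "H t x = T t x" if "t \<in> {0..1}" for t x
    using H'[OF that] by (simp add: T_def trig_poly_def)
  have pos: "T t x > 0" if "t \<in> {0..1}" for t x
    using path HT[OF that] that unfolding positive_path_gen_def by metis
  have [continuous_intros]: "continuous_on S (\<lambda>z. a j (f z))" "continuous_on S (\<lambda>z. b j (f z))"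
    if "continuous_on S f" for j S and f :: "'c::t2_space \<Rightarrow> real"
    using that sm by (auto intro: continuous_on_compose2[OF smooth_imp_continuous_on[of _ UNIV]])
  have cT [continuous_intros]: "continuous_on S (\<lambda>z. T (f z) (g z))"
    if "continuous_on S f" "continuous_on S g" for S f and g :: "'c::t2_space \<Rightarrow> real"
    unfolding T_def using that by (intro continuous_intros)
  obtain d \<tau> where d: "(\<Sum>r<2*k. d r) = pi * real k"
    and shift: "\<And>a b x u \<delta>. (\<And>y. trig_poly k a b y \<ge> 0) \<Longrightarrow> 0 \<le> u \<Longrightarrow> u \<le> \<delta> \<Longrightarrow>
      trig_poly k a b x - integral {0..\<delta>} (\<lambda>v. \<Sum>r<2*k. d r * trig_poly k a b (x + v + \<tau> r))
        \<le> trig_poly k a b (x + u)"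
    by (rule trig_poly_shift_lower[OF k]) blast
  define \<delta> where "\<delta> = s / (4 * real k)"
  have \<delta>: "\<delta> > 0" using s k by (simp add: \<delta>_def)
  define K where "K t x = T t x - integral {0..\<delta>} (\<lambda>v. \<Sum>r<2*k. d r * T t (x + v + \<tau> r))" for t x
  have cK: "continuous_on S (\<lambda>(t, x). K t x)" for S
  proof -
    have "continuous_on S (\<lambda>z. integral (cbox 0 \<delta>) (\<lambda>v. \<Sum>r<2*k. d r * T (fst z) (snd z + v + \<tau> r)))"
      by (intro integral_continuous_on_param) (auto simp: case_prod_beta intro!: continuous_intros)
    then show ?thesis unfolding K_def case_prod_beta by (auto intro!: continuous_intros)
  qed
  have cK' [continuous_intros]: "continuous_on S (\<lambda>z. K (f z) (g z))"
    if "continuous_on S f" "continuous_on S g" for S f and g :: "'c::t2_space \<Rightarrow> real"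
    using continuous_on_compose2[OF cK[of UNIV] continuous_on_Pair[OF that]] by simp
  have intT: "((\<lambda>x. T t (x + c)) has_integral a 0 t) {0..1}" for t c
    unfolding T_def using has_integral_trig_poly[of k "\<lambda>j. a j t" "\<lambda>j. b j t" c] .
  \<comment> \<open>All translates of \<open>T t\<close> have the same mean \<open>a 0 t\<close>.
    The subtracted term therefore averages to this mean times the total weight \<open>pi * k\<close>
    times the length \<open>\<delta> = s / (4 * k)\<close>.\<close>
  have intK: "integral {0..1} (K t) = (1 - s * pi / 4) * a 0 t" for t
  proof -
    have "integral {0..1} (\<lambda>x. integral {0..\<delta>} (\<lambda>v. \<Sum>r<2*k. d r * T t (x + v + \<tau> r)))
      = integral {0..\<delta>} (\<lambda>v. integral {0..1} (\<lambda>x. \<Sum>r<2*k. d r * T t (x + v + \<tau> r)))"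
    proof -
      have "continuous_on (cbox (0, 0) (1, \<delta>)) (\<lambda>(x, v). \<Sum>r<2*k. d r * T t (x + v + \<tau> r))"
        unfolding case_prod_beta by (intro continuous_intros)
      from integral_swap_continuous[OF this] show ?thesis by simp
    qed
    also have "(\<lambda>v. integral {0..1} (\<lambda>x. \<Sum>r<2*k. d r * T t (x + v + \<tau> r))) = (\<lambda>v. pi * real k * a 0 t)"
    proof
      fix v
      have "((\<lambda>x. \<Sum>r<2*k. d r * T t (x + v + \<tau> r)) has_integral (\<Sum>r<2*k. d r * a 0 t)) {0..1}"
        unfolding add.assoc by (intro has_integral_sum has_integral_mult_right intT) auto
      then show "integral {0..1} (\<lambda>x. \<Sum>r<2*k. d r * T t (x + v + \<tau> r)) = pi * real k * a 0 t"
        by (simp add: integral_unique d flip: sum_distrib_right)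
    qed
    also have "integral {0..\<delta>} (\<lambda>v. pi * real k * a 0 t) = s * pi / 4 * a 0 t"
      using \<delta> k by (simp add: \<delta>_def)
    finally have 1: "integral {0..1} (\<lambda>x. integral {0..\<delta>} (\<lambda>v. \<Sum>r<2*k. d r * T t (x + v + \<tau> r))) = s * pi / 4 * a 0 t" .
    have "continuous_on {0..1} (\<lambda>x. T t x - K t x)" by (intro continuous_intros)
    then have "integral {0..1} (K t) = integral {0..1} (T t) - integral {0..1} (\<lambda>x. T t x - K t x)"
      by (subst integral_diff[symmetric]) (auto intro!: integrable_continuous_interval continuous_intros)
    also have "integral {0..1} (T t) = a 0 t" using integral_unique[OF intT[of t 0]] by simp
    finally show ?thesis using 1 by (simp add: K_def[abs_def] left_diff_distrib)
  qed
  have der: "((\<lambda>t. \<Phi> t x) has_vector_derivative T t (\<Phi> t x)) (at t within {0..1})" if "t \<in> {0..1}" for t x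
    using path that HT[OF that, symmetric]
    unfolding positive_path_gen_def has_real_derivative_iff_has_vector_derivative[symmetric] by simp
  have ftc: "((\<lambda>t. T t (\<Phi> t x)) has_integral \<Phi> v x - \<Phi> u x) {u..v}" if "0 \<le> u" "u \<le> v" "v \<le> 1" for u v x
    using that by (intro fundamental_theorem_of_calculus)
      (auto intro!: has_vector_derivative_within_subset[OF der])
  have incr: "\<Phi> u x \<le> \<Phi> v x" if "0 \<le> u" "u \<le> v" "v \<le> 1" for u v x
    using has_integral_nonneg[OF ftc[OF that, of x]] pos[THEN less_imp_le] that by force
  have ends: "\<Phi> 0 x = x" "\<Phi> 1 x = \<phi> x" for x using path unfolding positive_path_gen_def by auto
  \<comment> \<open>Trajectories increase from \<open>x\<close> to \<open>\<phi> x\<close>, so the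
    displacement \<open>\<Phi> t x - x\<close> stays in \<open>{0..\<delta>}\<close> and is an
    admissible \<open>u\<close> in \<open>shift\<close>.\<close>
  have pointwise: "integral {0..1} (\<lambda>t. K t x) \<le> \<phi> x - x" for x
  proof (rule has_integral_le[OF integrable_integral])
    show "((\<lambda>t. T t (\<Phi> t x)) has_integral \<phi> x - x) {0..1}" using ftc[of 0 1 x] ends by simp
    show "(\<lambda>t. K t x) integrable_on {0..1}" by (intro integrable_continuous_interval continuous_intros)
    fix t :: real assume t: "t \<in> {0..1}"
    have "0 \<le> \<Phi> t x - x" "\<Phi> t x - x \<le> \<delta>"
      using incr[of 0 t x] incr[of t 1 x] le[of x] ends t by (auto simp: \<delta>_def)
    then show "K t x \<le> T t (\<Phi> t x)"
      using shift[of "\<lambda>j. a j t" "\<lambda>j. b j t" "\<Phi> t x - x" \<delta> x] pos[OF t, THEN less_imp_le]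
      unfolding K_def T_def by simp
  qed
  have a0: "a 0 t \<ge> 0" if "t \<in> {0..1}" for t
    using has_integral_nonneg[OF intT[of t 0]] pos[OF that, THEN less_imp_le] by simp
  have inta: "a 0 integrable_on {0..1}" by (intro integrable_continuous_interval smooth_imp_continuous_on sm)
  \<comment> \<open>The constant is rounded using \<open>pi < 4\<close>, which is allowed because
    \<open>a 0\<close> is nonnegative on the interval.\<close>
  have "(1 - s) * integral {0..1} (a 0) \<le> (1 - s * pi / 4) * integral {0..1} (a 0)"
    using s pi_less_4 a0 by (intro mult_right_mono integral_nonneg inta) auto
  also have "\<dots> = integral {0..1} (\<lambda>t. integral {0..1} (K t))" by (simp add: intK)
  also have "\<dots> = integral {0..1} (\<lambda>x. integral {0..1} (\<lambda>t. K t x))"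
    using integral_swap_continuous[of 0 0 1 1 K] cK by simp
  also have "\<dots> \<le> integral {0..1} (\<lambda>x. \<phi> x - x)"
  proof (rule integral_le)
    have "continuous_on {0..1} (\<lambda>x. integral (cbox 0 1) (\<lambda>t. K t x))"
      by (intro integral_continuous_on_param) (auto simp: case_prod_beta intro!: continuous_intros)
    then show "(\<lambda>x. integral {0..1} (\<lambda>t. K t x)) integrable_on {0..1}"
      by (intro integrable_continuous_interval) simp
    show "(\<lambda>x. \<phi> x - x) integrable_on {0..1}"
      by (intro integrable_continuous_interval continuous_intros cont)
  qed (rule pointwise)
  finally have main: "(1 - s) * integral {0..1} (a 0) \<le> integral {0..1} (\<lambda>x. \<phi> x - x)" .
  have "lengthV H \<le> integral {0..1} (a 0)"
  proof (cases "(\<lambda>t. inverse (integral {0..1} (\<lambda>x. 1 / H t x))) integrable_on {0..1}")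
    case True
    show ?thesis unfolding lengthV_def
    proof (rule integral_le[OF True inta])
      fix t :: real assume t: "t \<in> {0..1}"
      have "inverse (integral {0..1} (\<lambda>x. 1 / T t x)) \<le> integral {0..1} (T t)"
        using pos[OF t] by (intro harmonic_le_arithmetic_mean continuous_intros)
      also have "integral {0..1} (T t) = a 0 t" using integral_unique[OF intT[of t 0]] by simp
      finally show "inverse (integral {0..1} (\<lambda>x. 1 / H t x)) \<le> a 0 t" by (simp add: HT[OF t])
    qed
  next
    \<comment> \<open>Here \<open>integral\<close> takes its default value \<open>0\<close>, which
      lies below the nonnegative integral of \<open>a 0\<close>.\<close>
    case False
    then show ?thesis unfolding lengthV_def
      using a0 integral_nonneg[OF inta] by (simp add: not_integrable_integral)
  qed
  also have "\<dots> \<le> 1 / (1 - s) * integral {0..1} (\<lambda>x. \<phi> x - x)"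
    using main s by (simp add: field_simps)
  finally show ?thesis .
qed

section \<open>Smoothness, translations and uniform gaps\<close>

text \<open>The span of \<open>cos (c * x)\<close> and \<open>sin (c * x)\<close> is closed under
  differentiation, so the induction carries arbitrary coefficients.\<close>

lemma smooth_sinusoid: "smooth (\<lambda>x. A * cos (c * x) + B * sin (c * x))"
proof -
  have "\<exists>A' B'. (deriv ^^ n) (\<lambda>x. A * cos (c * x) + B * sin (c * x)) = (\<lambda>x. A' * cos (c * x) + B' * sin (c * x))" for n
  proof (induction n)
    case (Suc n)
    then obtain A' B' where e: "(deriv ^^ n) (\<lambda>x. A * cos (c * x) + B * sin (c * x)) = (\<lambda>x. A' * cos (c * x) + B' * sin (c * x))"
      by blast
    have "deriv (\<lambda>x. A' * cos (c * x) + B' * sin (c * x)) = (\<lambda>x. (B' * c) * cos (c * x) + (- A' * c) * sin (c * x))"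
      by (rule ext, rule DERIV_imp_deriv) (auto intro!: derivative_eq_intros)
    then show ?case unfolding funpow.simps o_def e by blast
  qed auto
  moreover have "(\<lambda>x. A * cos (c * x) + B * sin (c * x)) differentiable at x" for A B x
    unfolding real_differentiable_def by (rule exI) (auto intro!: derivative_eq_intros)
  ultimately show ?thesis unfolding smooth_def by metis
qed

lemma smooth_const: "smooth (\<lambda>x. A)"
  using smooth_sinusoid[of A 0 0] by simp

lemma smooth_translation: "smooth (\<lambda>x. x + c)"
  unfolding smooth_def
proof (intro allI)
  fix n x
  have d: "deriv (\<lambda>x::real. x + c) = (\<lambda>x. 1)"
    by (rule ext, rule DERIV_imp_deriv) (auto intro!: derivative_eq_intros)
  show "(deriv ^^ n) (\<lambda>x. x + c) differentiable at x"
  proof (cases n)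
    case 0
    then show ?thesis by simp
  next
    case (Suc m)
    then show ?thesis using smooth_const[of 1] by (simp only: funpow_Suc_right o_apply d smooth_def)
  qed
qed

lemma translation_in_Diff1: "(\<lambda>x. x + c) \<in> Diff1"
proof -
  have "inv (\<lambda>x::real. x + c) = (\<lambda>x. x + - c)" by (rule inv_equality) auto
  moreover have "bij (\<lambda>x::real. x + c)" by (rule bij_betw_byWitness[where f'="\<lambda>x. x - c"]) auto
  ultimately show ?thesis unfolding Diff1_def using smooth_translation[of c] smooth_translation[of "- c"] by simp
qed

text \<open>The displacement \<open>\<phi> x - x\<close> is continuous and 1-periodic, hence attains
  its minimum, which exceeds \<open>c\<close>. Taking half of the excess as \<open>v\<close> keeps
  the inequality strict.\<close>

lemma Diff1_gap:
  assumes "\<phi> \<in> Diff1" "\<And>x. \<phi> x > x + c"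
  obtains v where "v > 0" "\<And>x. x + c + v < \<phi> x"
proof -
  have p: "\<phi> (x + 1) = \<phi> x + 1" for x using assms(1) by (simp add: Diff1_def)
  interpret periodic_fun_simple' "\<lambda>x. \<phi> x - x" by standard (simp add: p)
  have "continuous_on {0..1} (\<lambda>x. \<phi> x - x)"
    using assms(1) by (intro continuous_intros smooth_imp_continuous_on) (simp add: Diff1_def)
  then have "\<exists>y\<in>{0..1}. \<forall>x\<in>{0..1}. \<phi> y - y \<le> \<phi> x - x"
    by (intro continuous_attains_inf) auto
  then obtain y where y: "\<And>x. x \<in> {0..1} \<Longrightarrow> \<phi> y - y \<le> \<phi> x - x"
    by blast
  have "\<phi> y - y \<le> \<phi> x - x" for x
    using y[of "frac x"] plus_of_int[of "frac x" "\<lfloor>x\<rfloor>"] frac_lt_1[of x]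
    by (simp add: frac_def)
  then have "x + c + (\<phi> y - y - c) / 2 < \<phi> x" for x
  proof -
    have "\<phi> y - y \<le> \<phi> x - x" by fact
    then show ?thesis using assms(2)[of y] by (simp add: field_simps)
  qed
  then show thesis
    using assms(2)[of y] by (intro that[of "(\<phi> y - y - c) / 2"]) auto
qed

section \<open>The flow of a sinusoidal Hamiltonian and its harmonic mean\<close>

text \<open>A primitive of the Poisson-type kernel \<open>sqrt (\<alpha>\<^sup>2 - M\<^sup>2) / (\<alpha> - M cos (2 \<pi> k y))\<close>, written with an
  \<open>arctan\<close> whose argument has no poles, so that it needs no choice of branches.\<close>

definition poisson_primitive :: "nat \<Rightarrow> real \<Rightarrow> real \<Rightarrow> real \<Rightarrow> real" where
  "poisson_primitive k \<alpha> M y = y + arctan (M * sin (2 * pi * real k * y) /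
      (\<alpha> + sqrt (\<alpha>\<^sup>2 - M\<^sup>2) - M * cos (2 * pi * real k * y))) / (pi * real k)"

lemma mult_cos_less:
  assumes "0 \<le> M" "M < \<alpha>"
  shows "M * cos y < (\<alpha>::real)"
  using assms mult_left_mono[OF cos_le_one[of y], of M] by simp

lemma DERIV_poisson_primitive:
  assumes k: "k \<ge> 1" and M: "0 \<le> M" "M < \<alpha>"
  shows "(poisson_primitive k \<alpha> M has_real_derivative sqrt (\<alpha>\<^sup>2 - M\<^sup>2) / (\<alpha> - M * cos (2 * pi * real k * y))) (at y)"
proof -
  define r where "r = sqrt (\<alpha>\<^sup>2 - M\<^sup>2)"
  define c where "c = cos (2 * pi * real k * y)"
  define s where "s = sin (2 * pi * real k * y)"
  have r0: "r \<ge> 0" and r2: "r\<^sup>2 = \<alpha>\<^sup>2 - M\<^sup>2" using M by (simp_all add: r_def power_mono)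
  have cs: "s\<^sup>2 + c\<^sup>2 = 1" by (simp add: s_def c_def)
  have p: "\<alpha> - M * c > 0" using mult_cos_less[OF M] by (simp add: c_def)
  define D where "D = \<alpha> + r - M * c"
  have D: "D > 0" using p r0 by (simp add: D_def)
  \<comment> \<open>Both this and \<open>num\<close> use \<open>r^2 = \<alpha>^2 - M^2\<close> to
    split off the factor \<open>\<alpha> + r\<close>, which cancels in the derivative of the
    arctangent term.\<close>
  have sq: "D\<^sup>2 + (M * s)\<^sup>2 = 2 * (\<alpha> + r) * (\<alpha> - M * c)"
  proof -
    have "D\<^sup>2 + (M * s)\<^sup>2 = (\<alpha> + r)\<^sup>2 - 2 * (\<alpha> + r) * (M * c) + M\<^sup>2 * (s\<^sup>2 + c\<^sup>2)"
      by (simp add: D_def power2_eq_square algebra_simps)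
    also have "\<dots> = 2 * (\<alpha> + r) * (\<alpha> - M * c)"
      unfolding cs using r2 by (simp add: power2_eq_square algebra_simps)
    finally show ?thesis .
  qed
  have num: "M * c * D - M * s * (M * s) = (\<alpha> + r) * (r - (\<alpha> - M * c))"
  proof -
    have "M * c * D - M * s * (M * s) = M * c * (\<alpha> + r) - M\<^sup>2 * (s\<^sup>2 + c\<^sup>2)"
      by (simp add: D_def power2_eq_square algebra_simps)
    also have "\<dots> = (\<alpha> + r) * (r - (\<alpha> - M * c))"
      unfolding cs using r2 by (simp add: power2_eq_square algebra_simps)
    finally show ?thesis .
  qed
  have ar: "\<alpha> + r > 0" using M r0 by simp
  have "((\<lambda>y. M * sin (2 * pi * real k * y) / (\<alpha> + r - M * cos (2 * pi * real k * y))) has_real_derivative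
     2 * pi * real k * (M * c * D - M * s * (M * s)) / D\<^sup>2) (at y)"
    using D unfolding D_def c_def s_def
    by (auto intro!: derivative_eq_intros simp: power2_eq_square algebra_simps)
  from DERIV_chain2[OF DERIV_arctan this]
  have "((\<lambda>y. arctan (M * sin (2 * pi * real k * y) / (\<alpha> + r - M * cos (2 * pi * real k * y)))) has_real_derivative
     inverse (1 + (M * s / D)\<^sup>2) * (2 * pi * real k * (M * c * D - M * s * (M * s)) / D\<^sup>2)) (at y)"
    by (simp add: D_def c_def s_def)
  from DERIV_add[OF DERIV_ident DERIV_cdivide[OF this, of "pi * real k"]]
  have "(poisson_primitive k \<alpha> M has_real_derivative
     1 + inverse (1 + (M * s / D)\<^sup>2) * (2 * pi * real k * (M * c * D - M * s * (M * s)) / D\<^sup>2) / (pi * real k)) (at y)"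
    unfolding poisson_primitive_def[abs_def] r_def by simp
  also have "1 + (M * s / D)\<^sup>2 = (D\<^sup>2 + (M * s)\<^sup>2) / D\<^sup>2" using D by (simp add: field_simps)
  also have "1 + inverse ((D\<^sup>2 + (M * s)\<^sup>2) / D\<^sup>2) * (2 * pi * real k * (M * c * D - M * s * (M * s)) / D\<^sup>2) / (pi * real k)
    = r / (\<alpha> - M * c)"
    unfolding sq num using D k p ar by (simp add: divide_simps) (simp add: algebra_simps)
  finally show ?thesis by (simp add: r_def c_def)
qed

text \<open>The correction term has period \<open>1 / k\<close>. The case \<open>m = 1\<close>
  identifies the time-one map of the flow, and \<open>m = k\<close> evaluates the integral over a
  full period.\<close>

lemma poisson_primitive_plus:
  assumes "k \<ge> 1"
  shows "poisson_primitive k \<alpha> M (y + real m / real k) = poisson_primitive k \<alpha> M y + real m / real k"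
proof -
  have "2 * pi * real k * (y + real m / real k) = 2 * pi * real k * y + 2 * pi * real m"
    using assms by (simp add: field_simps)
  moreover have "sin (z + 2 * pi * real m) = sin z" "cos (z + 2 * pi * real m) = cos z" for z
    using cos_2npi[of m] sin_2npi[of m] by (simp_all add: sin_add cos_add mult_ac)
  ultimately show ?thesis by (simp add: poisson_primitive_def)
qed

text \<open>The derivative is positive, and the distance to the identity is at most
  \<open>1\<close>, so a preimage of \<open>z\<close> lies in \<open>{z - 1..z + 1}\<close>.\<close>

lemma bij_poisson_primitive:
  assumes k: "k \<ge> 1" and M: "0 \<le> M" "M < \<alpha>"
  shows "bij (poisson_primitive k \<alpha> M)"
proof (rule bijI)
  let ?F = "poisson_primitive k \<alpha> M"
  note D = DERIV_poisson_primitive[OF assms]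
  have "M\<^sup>2 < \<alpha>\<^sup>2" using M by (simp add: power_strict_mono)
  then have pos: "sqrt (\<alpha>\<^sup>2 - M\<^sup>2) / (\<alpha> - M * cos y) > 0" for y using mult_cos_less[OF M, of y] by simp
  have "?F x < ?F y" if "x < y" for x y
    by (rule DERIV_pos_imp_increasing[OF that]) (use D pos in blast)
  then show "inj ?F" by (metis injI linorder_less_linear order_less_irrefl)
  have bd: "\<bar>?F y - y\<bar> \<le> 1" for y
  proof -
    have "\<bar>arctan w\<bar> \<le> pi * real k" for w
    proof -
      have "\<bar>arctan w\<bar> \<le> pi" using arctan_bounded[of w] by linarith
      also have "\<dots> \<le> pi * real k" using k by simp
      finally show ?thesis .
    qed
    then show ?thesis using k by (simp add: poisson_primitive_def abs_divide divide_le_eq)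
  qed
  show "surj ?F"
  proof (rule surj_def[THEN iffD2, rule_format])
    fix z
    have "continuous_on {z - 1..z + 1} ?F" using D by (intro DERIV_continuous_on) (blast intro: DERIV_subset)
    then show "\<exists>x. z = ?F x" using IVT'[of ?F "z - 1" z "z + 1"] bd[of "z - 1"] bd[of "z + 1"] by (force simp: abs_le_iff)
  qed
qed

text \<open>The primitive straightens the autonomous flow of
  \<open>\<alpha> - M * cos (2 * pi * k * y)\<close> to motion at constant speed
  \<open>sqrt (\<alpha>^2 - M^2)\<close>; its inverse \<open>G\<close> recovers the
  trajectories.\<close>

lemma DERIV_inv_poisson_primitive:
  assumes k: "k \<ge> 1" and M: "0 \<le> M" "M < \<alpha>"
  defines "G \<equiv> inv (poisson_primitive k \<alpha> M)"
  shows "(G has_real_derivative (\<alpha> - M * cos (2 * pi * real k * G z)) / sqrt (\<alpha>\<^sup>2 - M\<^sup>2)) (at z)"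
proof -
  let ?F = "poisson_primitive k \<alpha> M"
  note D = DERIV_poisson_primitive[OF k M]
  have bij: "bij ?F" by (rule bij_poisson_primitive[OF k M])
  have FG: "?F (G y) = y" and GF: "G (?F y) = y" for y
    using bij by (simp_all add: G_def bij_is_surj surj_f_inv_f bij_is_inj)
  have "isCont ?F y" for y using D DERIV_isCont by blast
  then have "isCont G (?F (G z))"
    by (intro isCont_inverse_function[where d=1 and f="?F"]) (simp_all add: GF)
  then have c: "isCont G z" by (simp add: FG)
  have "M\<^sup>2 < \<alpha>\<^sup>2" using M by (simp add: power_strict_mono)
  then have "sqrt (\<alpha>\<^sup>2 - M\<^sup>2) / (\<alpha> - M * cos (2 * pi * real k * G z)) \<noteq> 0"
    using mult_cos_less[OF M, of "2 * pi * real k * G z"] by simp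
  from DERIV_inverse_function[where g=G and x=z, OF D this, of "z - 1" "z + 1"] show ?thesis using FG c by simp
qed

lemma integral_inverse_poisson:
  assumes k: "k \<ge> 1" and M: "0 \<le> M" "M < \<alpha>"
  shows "integral {0..1} (\<lambda>x. 1 / (\<alpha> - M * cos (2 * pi * real k * (x - c)))) = 1 / sqrt (\<alpha>\<^sup>2 - M\<^sup>2)"
proof -
  let ?F = "poisson_primitive k \<alpha> M" and ?r = "sqrt (\<alpha>\<^sup>2 - M\<^sup>2)"
  have "M\<^sup>2 < \<alpha>\<^sup>2" using M by (simp add: power_strict_mono)
  then have r: "?r > 0" by simp
  have D: "((\<lambda>x. ?F (x - c) / ?r) has_real_derivative 1 / (\<alpha> - M * cos (2 * pi * real k * (x - c)))) (at x)" for x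
    using DERIV_cdivide[OF DERIV_poisson_primitive[OF assms, of "x + - c", unfolded DERIV_shift], where c="?r"] r
    by simp
  have "((\<lambda>x. 1 / (\<alpha> - M * cos (2 * pi * real k * (x - c)))) has_integral ?F (1 - c) / ?r - ?F (0 - c) / ?r) {0..1}"
    by (intro fundamental_theorem_of_calculus)
      (auto intro: DERIV_subset[OF D] simp flip: has_real_derivative_iff_has_vector_derivative)
  moreover have "?F (1 - c) = ?F (0 - c) + 1"
    using poisson_primitive_plus[OF k, of \<alpha> M "0 - c" k] k by (simp add: add.commute)
  ultimately show ?thesis by (simp add: integral_unique diff_divide_distrib[symmetric])
qed

section \<open>Arbitrarily long paths to one fixed translation\<close>

lemma long_path_to_translation:
  assumes k: "k \<ge> 1" and v: "v > 0"
  shows "\<exists>H \<Phi>. in_Pk k H \<and> positive_path_gen H \<Phi> (\<lambda>x. x + (1 / real k + v)) \<and> lengthV H > L"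
proof -
  \<comment> \<open>This gives \<open>2 * v * \<alpha> = L^2 + 2 * v > L^2\<close>, while
    \<open>\<alpha> \<ge> 1\<close> makes the radicand of \<open>M\<close> nonnegative.
    \<open>M\<close> is chosen so that the straightened speed is \<open>1 / k\<close> for every
    \<open>L\<close>.\<close>
  define \<alpha> where "\<alpha> = L\<^sup>2 / (2 * v) + 1"
  define M where "M = sqrt (\<alpha>\<^sup>2 - (1 / real k)\<^sup>2)"
  have \<alpha>: "\<alpha> \<ge> 1" using v by (simp add: \<alpha>_def)
  have "(1 / real k)\<^sup>2 \<le> 1" using k by (simp add: power_le_one)
  also have "1 \<le> \<alpha>\<^sup>2" using \<alpha> by simp
  finally have M2: "M\<^sup>2 = \<alpha>\<^sup>2 - (1 / real k)\<^sup>2" and M0: "M \<ge> 0" by (simp_all add: M_def)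
  have "M\<^sup>2 < \<alpha>\<^sup>2" using M2 k by simp
  then have M: "M < \<alpha>" using \<alpha> by (simp add: power_less_imp_less_base)
  have r: "sqrt (\<alpha>\<^sup>2 - M\<^sup>2) = 1 / real k" unfolding M2 by simp
  let ?F = "poisson_primitive k \<alpha> M"
  define G where "G = inv ?F"
  define H where "H t x = v + \<alpha> - M * cos (2 * pi * real k * (x - v * t))" for t x
  \<comment> \<open>In the frame moving with speed \<open>v\<close>, the coordinate
    \<open>?F\<close> advances at rate \<open>1 / k\<close>. After unit time it has advanced by
    \<open>1 / k\<close>, which is the effect of translating \<open>x\<close> by
    \<open>1 / k\<close>.\<close>
  define \<Phi> where "\<Phi> t x = v * t + G (?F x + t / real k)" for t x
  have GF: "G (?F x) = x" for x using bij_poisson_primitive[OF k M0 M] by (simp add: G_def bij_is_inj)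
  have "in_Pk k H" unfolding in_Pk_def
  proof (intro exI conjI allI ballI)
    let ?c = "2 * pi * real k * v"
    \<comment> \<open>The addition theorem turns the moving wave into two modes of frequency
      \<open>k\<close> with coefficients depending on \<open>t\<close>. The summands with factor
      \<open>0\<close> fit the shape of \<open>smooth_sinusoid\<close>.\<close>
    let ?a = "\<lambda>j t. if j = 0 then v + \<alpha> else if j = k then - M * cos (?c * t) + 0 * sin (?c * t) else 0"
    let ?b = "\<lambda>j t. if j = k then 0 * cos (?c * t) + - M * sin (?c * t) else 0"
    show "smooth (?a j)" "smooth (?b j)" for j
      by (cases "j = 0"; cases "j = k"; simp only: if_True if_False smooth_const smooth_sinusoid)+
    fix t x :: real assume "t \<in> {0..1}"
    have "(\<Sum>j\<le>k. ?a j t * cos (2 * pi * real j * x) + ?b j t * sin (2 * pi * real j * x))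
      = (\<Sum>j\<in>{0,k}. ?a j t * cos (2 * pi * real j * x) + ?b j t * sin (2 * pi * real j * x))"
      by (rule sum.mono_neutral_right) auto
    also have "\<dots> = v + \<alpha> - M * (cos (?c * t) * cos (2 * pi * real k * x) + sin (?c * t) * sin (2 * pi * real k * x))"
      using k by (simp add: algebra_simps)
    also have "\<dots> = H t x" by (simp add: H_def right_diff_distrib cos_diff mult_ac)
    finally show "H t x = (\<Sum>j\<le>k. ?a j t * cos (2 * pi * real j * x) + ?b j t * sin (2 * pi * real j * x))" ..
  qed
  moreover have "positive_path_gen H \<Phi> (\<lambda>x. x + (1 / real k + v))" unfolding positive_path_gen_def
  proof (intro conjI ballI allI)
    show "H t x > 0" for t x using mult_cos_less[OF M0 M, of "2 * pi * real k * (x - v * t)"] v by (simp add: H_def)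
    show "\<Phi> 0 = id" by (rule ext) (simp add: \<Phi>_def GF)
    show "\<Phi> 1 = (\<lambda>x. x + (1 / real k + v))"
      using poisson_primitive_plus[OF k, of \<alpha> M _ 1, symmetric] by (intro ext) (simp add: \<Phi>_def GF)
    fix x t :: real
    have "((\<lambda>t. G (?F x + t / real k)) has_real_derivative
        (\<alpha> - M * cos (2 * pi * real k * G (?F x + t / real k))) / sqrt (\<alpha>\<^sup>2 - M\<^sup>2) * (1 / real k)) (at t)"
      using DERIV_inv_poisson_primitive[OF k M0 M, of "?F x + t / real k"] unfolding G_def
      by (rule DERIV_chain2) (use k in \<open>auto intro!: derivative_eq_intros\<close>)
    from DERIV_add[OF DERIV_cmult[OF DERIV_ident, of v] this]
    have "((\<lambda>s. \<Phi> s x) has_real_derivative H t (\<Phi> t x)) (at t)"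
      using k by (simp add: \<Phi>_def[abs_def] H_def r algebra_simps)
    then show "((\<lambda>s. \<Phi> s x) has_real_derivative H t (\<Phi> t x)) (at t within {0..1})" by (rule DERIV_subset) simp
  qed
  moreover have "lengthV H > L"
  proof -
    \<comment> \<open>The moving frame raises the constant term from \<open>\<alpha>\<close> to
      \<open>v + \<alpha>\<close> and leaves \<open>M\<close> unchanged; the phase
      \<open>v * t\<close> does not affect the integral.\<close>
    have "integral {0..1} (\<lambda>x. 1 / H t x) = 1 / sqrt ((v + \<alpha>)\<^sup>2 - M\<^sup>2)" for t
      unfolding H_def using M v by (intro integral_inverse_poisson k M0) simp
    then have "lengthV H = sqrt ((v + \<alpha>)\<^sup>2 - M\<^sup>2)" by (simp add: lengthV_def)
    moreover have "L\<^sup>2 < (v + \<alpha>)\<^sup>2 - M\<^sup>2"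
    proof -
      have "L\<^sup>2 < 2 * v * \<alpha>" using v by (simp add: \<alpha>_def field_simps)
      also have "\<dots> \<le> v\<^sup>2 + 2 * v * \<alpha> + (1 / real k)\<^sup>2" by simp
      also have "\<dots> = (v + \<alpha>)\<^sup>2 - M\<^sup>2" unfolding M2 by (simp add: power2_sum)
      finally show ?thesis .
    qed
    ultimately show ?thesis by (simp add: real_less_rsqrt)
  qed
  ultimately show ?thesis by blast
qed

theorem theorem6:
  fixes k :: nat and \<phi> :: "real \<Rightarrow> real"
  assumes "k \<ge> 1" and "\<phi> \<in> Diff1"
  shows "(\<forall>s::real. 0 < s \<and> s < 1 \<and> (\<forall>x. \<phi> x \<le> x + s / (4 * real k)) \<longrightarrow>
            (\<forall>H \<Phi>. in_Pk k H \<and> positive_path_gen H \<Phi> \<phi> \<longrightarrow>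
               lengthV H \<le> (1 / (1 - s)) * integral {0..1} (\<lambda>x. \<phi> x - x)))
       \<and> ((\<forall>x. \<phi> x > x + 1 / real k) \<longrightarrow>
            (\<exists>\<psi>\<in>Diff1. (\<forall>x. x < \<psi> x \<and> \<psi> x < \<phi> x) \<and>
               (\<forall>L::real. \<exists>H \<Phi>. in_Pk k H \<and> positive_path_gen H \<Phi> \<psi> \<and> lengthV H > L)))"
proof (intro conjI allI impI)
  fix s H \<Phi>
  assume s: "0 < s \<and> s < 1 \<and> (\<forall>x. \<phi> x \<le> x + s / (4 * real k))"
    and "in_Pk k H \<and> positive_path_gen H \<Phi> \<phi>"
  moreover have "continuous_on {0..1} \<phi>"
    using assms(2) by (intro smooth_imp_continuous_on) (simp add: Diff1_def)
  ultimately show "lengthV H \<le> (1 / (1 - s)) * integral {0..1} (\<lambda>x. \<phi> x - x)"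
    by (intro lengthV_le[OF assms(1)]) auto
next
  assume "\<forall>x. \<phi> x > x + 1 / real k"
  then obtain v where v: "v > 0" "\<And>x. x + 1 / real k + v < \<phi> x"
    using Diff1_gap[OF assms(2), of "1 / real k"] by blast
  show "\<exists>\<psi>\<in>Diff1. (\<forall>x. x < \<psi> x \<and> \<psi> x < \<phi> x) \<and>
      (\<forall>L::real. \<exists>H \<Phi>. in_Pk k H \<and> positive_path_gen H \<Phi> \<psi> \<and> lengthV H > L)"
  \<comment> \<open>The target translation depends on the gap \<open>v\<close> alone, so the same
    \<open>\<psi>\<close> serves every \<open>L\<close>.\<close>
  proof (intro bexI[of _ "\<lambda>x. x + (1 / real k + v)"] conjI allI)
    show "x < x + (1 / real k + v)" "x + (1 / real k + v) < \<phi> x" for x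
      using v(1) v(2)[of x] by (simp_all add: add.assoc add_nonneg_pos)
    show "\<exists>H \<Phi>. in_Pk k H \<and> positive_path_gen H \<Phi> (\<lambda>x. x + (1 / real k + v)) \<and> lengthV H > L" for L
      by (rule long_path_to_translation[OF assms(1) v(1)])
  qed (rule translation_in_Diff1)
qed

end
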